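(* Let $\kappa>1$ be a real number and let $N$ be a positive integer. Let $\mathcal{D}_{[N/\kappa,N]}$ be the poset of all integers in the interval $[N/\kappa,N]$, ordered by divisibility. Then $$\dim(\mathcal{D}_{[N/\kappa,N]})\le \max\left(688\,\frac{(\log\kappa)^3}{(\log\log \kappa)^2},\,2\right).$$
   Context: $\log$ denotes the natural logarithm. For a set $R$ of positive integers, $\mathcal{D}_R$ denotes the poset on $R$ in which $a\le b$ if and only if $a$ divides $b$. The Dushnik–Miller dimension $\dim(P)$ of a finite poset $P$ is the least $d\in\mathbb{N}$ such that $P$ embeds (is order-isomorphic to a suborder, i.e. a subset with the restricted order) into a product of $d$ chains (linear orders), where a product of posets carries the coordinatewise order. For $\kappa=e$, where $\log\log\kappa=0$, the first term of the maximum is read as $+\infty$. *)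

theory Defs
  imports Complex_Main "HOL-Library.FuncSet" "HOL-Library.Extended_Real"
begin

text \<open>A poset is a carrier set together with a relation on it, as in \<^theory>\<open>HOL.Order_Relation\<close>.\<close>

definition divisibility_order :: "nat set \<Rightarrow> nat rel" where
  "divisibility_order R = {(a, b). a \<in> R \<and> b \<in> R \<and> a dvd b}"

definition poset_embeds :: "'a set \<Rightarrow> 'a rel \<Rightarrow> 'b set \<Rightarrow> 'b rel \<Rightarrow> bool" where
  "poset_embeds A r B s \<longleftrightarrow>
     (\<exists>f. inj_on f A \<and> f ` A \<subseteq> B \<and> (\<forall>x\<in>A. \<forall>y\<in>A. (x, y) \<in> r \<longleftrightarrow> (f x, f y) \<in> s))"

definition product_order :: "'i set \<Rightarrow> ('i \<Rightarrow> 'c set) \<Rightarrow> ('i \<Rightarrow> 'c rel) \<Rightarrow> ('i \<Rightarrow> 'c) rel" where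
  "product_order I C L =
     {(u, v). u \<in> Pi\<^sub>E I C \<and> v \<in> Pi\<^sub>E I C \<and> (\<forall>i\<in>I. (u i, v i) \<in> L i)}"

definition embeds_in_chains :: "'c itself \<Rightarrow> nat \<Rightarrow> 'a set \<Rightarrow> 'a rel \<Rightarrow> bool" where
  "embeds_in_chains _ d A r \<longleftrightarrow>
     (\<exists>(C :: nat \<Rightarrow> 'c set) L.
        (\<forall>i<d. linear_order_on (C i) (L i)) \<and>
        poset_embeds A r (Pi\<^sub>E {..<d} C) (product_order {..<d} C L))"

text \<open>
  A definition cannot quantify over types, so the chains below (arbitrary linear orders on
  arbitrary carriers) have elements of type \<^typ>\<open>nat\<close>. For a finite poset this is no restriction
  (lemma \<open>embeds_in_chains_nat\<close>), and the least \<open>d\<close> exists (lemma \<open>embeds_in_chains_poset_dim\<close>).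
\<close>

definition poset_dim :: "'a set \<Rightarrow> 'a rel \<Rightarrow> nat" where
  "poset_dim A r = (LEAST d. embeds_in_chains TYPE(nat) d A r)"

definition dim_bound :: "real \<Rightarrow> ereal" where
  "dim_bound \<kappa> =
     max (if ln (ln \<kappa>) = 0 then \<infinity> else ereal (688 * (ln \<kappa> ^ 3 / (ln (ln \<kappa>)) ^ 2))) 2"

lemma linear_order_on_nat_le: "linear_order_on UNIV {(a, b :: nat). a \<le> b}"
  by (auto simp: linear_order_on_def partial_order_on_def preorder_on_def refl_on_def
      trans_def antisym_def total_on_def)

lemma embeds_in_chains_natI:
  assumes "inj_on g A" and "g ` A \<subseteq> Pi\<^sub>E {..<d} (\<lambda>_. UNIV)"
    and "\<And>x y. x \<in> A \<Longrightarrow> y \<in> A \<Longrightarrow> (x, y) \<in> r \<longleftrightarrow>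
      (g x, g y) \<in> product_order {..<d} (\<lambda>_. UNIV) (\<lambda>_. {(a, b :: nat). a \<le> b})"
  shows "embeds_in_chains TYPE(nat) d A r"
proof -
  have "poset_embeds A r (Pi\<^sub>E {..<d} (\<lambda>_. UNIV))
      (product_order {..<d} (\<lambda>_. UNIV) (\<lambda>_. {(a, b :: nat). a \<le> b}))"
    unfolding poset_embeds_def by (rule exI[of _ g]) (use assms in blast)
  then show ?thesis
    unfolding embeds_in_chains_def using linear_order_on_nat_le
    by (intro exI[of _ "\<lambda>_. UNIV"] exI[of _ "\<lambda>_. {(a, b). a \<le> b}"] conjI) simp_all
qed

lemma embeds_in_chains_nat:
  assumes fin: "finite A" and emb: "embeds_in_chains TYPE('c) d A r"
  shows "embeds_in_chains TYPE(nat) d A r"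
proof -
  obtain C :: "nat \<Rightarrow> 'c set" and L where
    lin: "\<And>i. i < d \<Longrightarrow> linear_order_on (C i) (L i)" and
    pe: "poset_embeds A r (Pi\<^sub>E {..<d} C) (product_order {..<d} C L)"
    using emb unfolding embeds_in_chains_def by auto
  obtain f where
    inj: "inj_on f A" and fC: "f ` A \<subseteq> Pi\<^sub>E {..<d} C" and
    iff: "\<And>x y. x \<in> A \<Longrightarrow> y \<in> A \<Longrightarrow> (x, y) \<in> r \<longleftrightarrow> (f x, f y) \<in> product_order {..<d} C L"
    using pe unfolding poset_embeds_def by auto
  define S where "S i = (\<lambda>x. f x i) ` A" for i
  define rk where "rk i c = card {c' \<in> S i. (c', c) \<in> L i}" for i c
  have finS: "finite (S i)" for i using fin by (simp add: S_def)
  have rk: "(c, c') \<in> L i \<longleftrightarrow> rk i c \<le> rk i c'" if "i < d" "c \<in> S i" "c' \<in> S i" for i c c'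
  proof -
    have SC: "S i \<subseteq> C i" using fC \<open>i < d\<close> by (auto simp: S_def)
    have cC: "c \<in> C i" "c' \<in> C i" using SC that(2,3) by auto
    have lo: "refl_on (C i) (L i)" "trans (L i)" "total_on (C i) (L i)"
      using lin[OF \<open>i < d\<close>] by (simp_all add: linear_order_on_def partial_order_on_def preorder_on_def)
    have rf: "(c, c) \<in> L i" using lo(1) cC(1) by (rule refl_onD)
    have tr: "(x, z) \<in> L i" if "(x, y) \<in> L i" "(y, z) \<in> L i" for x y z
      using lo(2) that by (rule transD)
    have tot: "c \<noteq> c' \<Longrightarrow> (c, c') \<in> L i \<or> (c', c) \<in> L i"
      using lo(3) cC by (simp add: total_on_def)
    have "rk i c \<le> rk i c'" if "(c, c') \<in> L i"
      unfolding rk_def using that finS by (intro card_mono) (auto intro: tr)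
    moreover have "rk i c' < rk i c" if "(c, c') \<notin> L i"
    proof -
      have 1: "(c', c) \<in> L i" using tot rf that by auto
      have "{z \<in> S i. (z, c') \<in> L i} \<subset> {z \<in> S i. (z, c) \<in> L i}"
        using tr[OF _ 1] rf that \<open>c \<in> S i\<close> by blast
      then show ?thesis unfolding rk_def using finS by (intro psubset_card_mono) auto
    qed
    ultimately show ?thesis by fastforce
  qed
  define g where "g x = (\<lambda>i\<in>{..<d}. rk i (f x i))" for x
  have giff: "(x, y) \<in> r \<longleftrightarrow> (g x, g y) \<in> product_order {..<d} (\<lambda>_. UNIV) (\<lambda>_. {(a, b). a \<le> b})"
    if "x \<in> A" "y \<in> A" for x y
  proof -
    have "(x, y) \<in> r \<longleftrightarrow> (\<forall>i<d. (f x i, f y i) \<in> L i)"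
      using iff[OF that] fC that by (auto simp: product_order_def)
    also have "\<dots> \<longleftrightarrow> (\<forall>i<d. rk i (f x i) \<le> rk i (f y i))"
      using rk that by (auto simp: S_def)
    finally show ?thesis by (auto simp: product_order_def g_def)
  qed
  have "inj_on g A"
  proof (rule inj_onI)
    fix x y assume xy: "x \<in> A" "y \<in> A" "g x = g y"
    have "f x i = f y i" if "i < d" for i
    proof -
      have "rk i (f x i) = rk i (f y i)" using fun_cong[OF xy(3), of i] that by (simp add: g_def)
      moreover have S: "f x i \<in> S i" "f y i \<in> S i" using xy by (auto simp: S_def)
      ultimately have "(f x i, f y i) \<in> L i" "(f y i, f x i) \<in> L i" using rk[OF that] by auto
      moreover have "antisym (L i)"
        using lin[OF that] by (simp add: linear_order_on_def partial_order_on_def)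
      ultimately show ?thesis by (simp add: antisymD)
    qed
    then have "f x = f y" using fC xy by (intro PiE_ext[of "f x" "{..<d}" C "f y"]) auto
    then show "x = y" using inj xy by (auto dest: inj_onD)
  qed
  moreover have "g ` A \<subseteq> Pi\<^sub>E {..<d} (\<lambda>_. UNIV)" by (auto simp: g_def split: if_splits)
  ultimately show ?thesis
    by (intro embeds_in_chains_natI[of g]) (simp_all add: giff)
qed

lemma embeds_in_chains_card:
  assumes fin: "finite A" and po: "partial_order_on A r"
  shows "embeds_in_chains TYPE(nat) (card A) A r"
proof -
  have rf: "(x, x) \<in> r" if "x \<in> A" for x
    using po that by (simp add: partial_order_on_def preorder_on_def refl_on_def)
  have tr: "(x, z) \<in> r" if "(x, y) \<in> r" "(y, z) \<in> r" for x y z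
    using po that unfolding partial_order_on_def preorder_on_def by (meson transD)
  have as: "x = y" if "(x, y) \<in> r" "(y, x) \<in> r" for x y
    using po that unfolding partial_order_on_def by (meson antisymD)
  obtain h where h: "bij_betw h {..<card A} A"
    using ex_bij_betw_nat_finite[OF fin] by (auto simp: atLeast0LessThan)
  define g where "g x = (\<lambda>i\<in>{..<card A}. if (h i, x) \<in> r then 1 else 0 :: nat)" for x
  have down: "(x, y) \<in> r \<longleftrightarrow> (\<forall>a\<in>A. (a, x) \<in> r \<longrightarrow> (a, y) \<in> r)" if "x \<in> A" "y \<in> A" for x y
    using rf tr that by blast
  have giff: "(x, y) \<in> r \<longleftrightarrow>
      (g x, g y) \<in> product_order {..<card A} (\<lambda>_. UNIV) (\<lambda>_. {(a, b). a \<le> b})"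
    if "x \<in> A" "y \<in> A" for x y
  proof -
    have "(x, y) \<in> r \<longleftrightarrow> (\<forall>a\<in>h ` {..<card A}. (a, x) \<in> r \<longrightarrow> (a, y) \<in> r)"
      using down[OF that] h by (simp add: bij_betw_def)
    then show ?thesis by (auto simp: product_order_def g_def)
  qed
  have "inj_on g A"
  proof (rule inj_onI)
    fix x y assume xy: "x \<in> A" "y \<in> A" "g x = g y"
    have "(x, y) \<in> r" "(y, x) \<in> r"
      using rf[OF xy(1)] giff[of x x] giff[of x y] giff[of y x] xy by simp_all
    then show "x = y" by (rule as)
  qed
  moreover have "g ` A \<subseteq> Pi\<^sub>E {..<card A} (\<lambda>_. UNIV)" by (auto simp: g_def split: if_splits)
  ultimately show ?thesis
    by (intro embeds_in_chains_natI[of g]) (simp_all add: giff)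
qed

lemma embeds_in_chains_poset_dim:
  assumes "finite A" and "partial_order_on A r"
  shows "embeds_in_chains TYPE(nat) (poset_dim A r) A r"
  unfolding poset_dim_def using embeds_in_chains_card[OF assms] by (rule LeastI)

lemma poset_dim_le:
  assumes "finite A" and "embeds_in_chains TYPE('c) d A r"
  shows "poset_dim A r \<le> d"
  unfolding poset_dim_def using embeds_in_chains_nat[OF assms] by (rule Least_le)

lemma partial_order_on_divisibility_order:
  "partial_order_on R (divisibility_order R)"
  unfolding partial_order_on_def preorder_on_def divisibility_order_def
  by (auto simp: refl_on_def trans_def antisym_def intro: dvd_trans dvd_antisym)

end

theory Submission
  imports Defs "HOL-Computational_Algebra.Primes"
begin

text \<open>
  It suffices to find few monotone real functions such that whenever \<open>a\<close> does not divide \<open>b\<close>, one of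
  them is larger at \<open>a\<close> than at \<open>b\<close>. Comparable elements have the same \<open>\<kappa>\<close>-rough part, so the rough
  part and its negative are monotone, and only the set \<open>T\<close> of primes \<open>p \<le> \<kappa>\<close> at which the
  multiplicities of \<open>a\<close> and \<open>b\<close> differ matters. Let \<open>L = ln \<kappa>\<close>, \<open>l = ln L\<close> and \<open>t = O(L / l)\<close>.

  If \<open>T\<close> has at most \<open>t\<close> elements, a set \<open>S\<close> of primes with \<open>S \<inter> T = {p}\<close>, where \<open>p\<close> has larger
  multiplicity in \<open>a\<close>, makes the \<open>S\<close>-part of \<open>a\<close> larger than that of \<open>b\<close>. A random \<open>S\<close> of density
  \<open>1 / t\<close> works with probability about \<open>1 / t\<close>, so \<open>O(t\<^sup>2 L)\<close> sets serve all pairs \<open>(T, p)\<close>.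

  If \<open>T\<close> is larger, partition the primes into blocks. On a block \<open>S\<close> with all primes at least \<open>y\<close>, order
  by the integer part of the (shifted) logarithm to base \<open>y\<close> of the \<open>S\<close>-part; integers of equal level
  with different \<open>S\<close>-parts are incomparable, so ties may be broken in both directions. If these functions
  do not separate \<open>a\<close> from \<open>b\<close> and \<open>S\<close> meets \<open>T\<close>, then the \<open>S\<close>-part of \<open>b\<close> exceeds that of \<open>a\<close> by a
  factor of at least \<open>\<surd>y\<close>. Since \<open>b \<le> \<kappa> a\<close> and \<open>y = \<surd>L\<close> for all blocks but one, at most \<open>4 L / l\<close>
  blocks can meet \<open>T\<close>; but among \<open>O(L)\<close> random partitions into \<open>O((L / l)\<^sup>2)\<close> blocks, one has more blocks
  meeting \<open>T\<close>.
\<close>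

subsection \<open>Realizers and random families of sets\<close>

text \<open>Evaluation at the members of \<open>\<F>\<close> is the embedding; it is injective
  because equal values put both \<open>(x, y)\<close> and \<open>(y, x)\<close> in \<open>r\<close>.
  Thus monotone functions serve in place of linear extensions.\<close>

lemma poset_dim_le_card_family:
  fixes \<F> :: "('a \<Rightarrow> 'c::linorder) set"
  assumes "finite A" "partial_order_on A r" "finite \<F>"
    and mono: "\<And>f x y. f \<in> \<F> \<Longrightarrow> (x, y) \<in> r \<Longrightarrow> f x \<le> f y"
    and sep: "\<And>x y. x \<in> A \<Longrightarrow> y \<in> A \<Longrightarrow> (x, y) \<notin> r \<Longrightarrow> \<exists>f\<in>\<F>. f y < f x"
  shows "poset_dim A r \<le> card \<F>"
proof -
  obtain e where e: "bij_betw e {..<card \<F>} \<F>"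
    using ex_bij_betw_nat_finite[OF \<open>finite \<F>\<close>] by (auto simp: atLeast0LessThan)
  define g where "g x = (\<lambda>i\<in>{..<card \<F>}. e i x)" for x
  let ?C = "\<lambda>_::nat. UNIV :: 'c set" and ?L = "\<lambda>_::nat. {(u, v :: 'c). u \<le> v}"
  have giff: "(x, y) \<in> r \<longleftrightarrow> (g x, g y) \<in> product_order {..<card \<F>} ?C ?L"
    if "x \<in> A" "y \<in> A" for x y
  proof -
    have "(x, y) \<in> r \<longleftrightarrow> (\<forall>f\<in>e ` {..<card \<F>}. f x \<le> f y)"
      using mono[of _ x y] sep[OF that] e by (fastforce simp: bij_betw_def not_le[symmetric])
    then show ?thesis by (auto simp: product_order_def g_def)
  qed
  have "inj_on g A"
  proof (rule inj_onI)
    fix x y assume xy: "x \<in> A" "y \<in> A" "g x = g y"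
    have "(x, x) \<in> r"
      using assms(2) xy(1) by (simp add: partial_order_on_def preorder_on_def refl_on_def)
    then have "(x, y) \<in> r" "(y, x) \<in> r"
      using giff[of x x] giff[of x y] giff[of y x] xy by simp_all
    then show "x = y" using assms(2) by (meson antisymD partial_order_on_def)
  qed
  moreover have "linear_order_on UNIV {(u, v :: 'c). u \<le> v}"
    by (auto simp: linear_order_on_def partial_order_on_def preorder_on_def refl_on_def
        trans_def antisym_def total_on_def)
  moreover have "g ` A \<subseteq> Pi\<^sub>E {..<card \<F>} ?C" by (auto simp: g_def split: if_splits)
  ultimately have "embeds_in_chains TYPE('c) (card \<F>) A r"
    unfolding embeds_in_chains_def poset_embeds_def
    using giff by (intro exI[of _ ?C] exI[of _ ?L] conjI exI[of _ g]) simp_all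
  then show ?thesis by (rule poset_dim_le[OF \<open>finite A\<close>])
qed

section \<open>The probabilistic method by finite counting\<close>

text \<open>A union bound made deterministic. By averaging, some \<open>w\<close> fails for at most
  a fraction \<open>\<delta>\<close> of the points not yet satisfied; after \<open>M\<close> such
  choices fewer than one point is left.\<close>

lemma greedy_cover:
  fixes \<delta> :: real
  assumes fin: "finite X" "finite \<Omega>" and ne: "\<Omega> \<noteq> {}" and "\<delta> \<ge> 0"
    and fail: "\<And>x. x \<in> X \<Longrightarrow> real (card {w \<in> \<Omega>. \<not> sat x w}) \<le> \<delta> * card \<Omega>"
    and small: "real (card X) * \<delta> ^ M < 1"
  obtains F where "F \<subseteq> \<Omega>" "card F \<le> M" "\<And>x. x \<in> X \<Longrightarrow> \<exists>w\<in>F. sat x w"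
proof -
  have "\<exists>F\<subseteq>\<Omega>. card F \<le> n \<and> real (card {x \<in> X. \<forall>w\<in>F. \<not> sat x w}) \<le> card X * \<delta> ^ n" for n
  proof (induction n)
    case 0
    show ?case by (rule exI[of _ "{}"]) simp
  next
    case (Suc n)
    then obtain F where F: "F \<subseteq> \<Omega>" "card F \<le> n"
      "real (card {x \<in> X. \<forall>w\<in>F. \<not> sat x w}) \<le> card X * \<delta> ^ n" by blast
    define Y where "Y = {x \<in> X. \<forall>w\<in>F. \<not> sat x w}"
    have finY: "finite Y" using fin by (simp add: Y_def)
    \<comment> \<open>Double counting of the failing pairs \<open>(x, w)\<close> with
      \<open>x\<close> in \<open>Y\<close>.\<close>
    have "(\<Sum>w\<in>\<Omega>. card {x \<in> Y. \<not> sat x w}) = (\<Sum>x\<in>Y. card {w \<in> \<Omega>. \<not> sat x w})"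
      by (rule sum_multicount_gen) (use fin finY in auto)
    then have "(\<Sum>w\<in>\<Omega>. real (card {x \<in> Y. \<not> sat x w})) = (\<Sum>x\<in>Y. real (card {w \<in> \<Omega>. \<not> sat x w}))"
      by (simp only: of_nat_sum[symmetric])
    also have "\<dots> \<le> (\<Sum>x\<in>Y. \<delta> * card \<Omega>)" by (rule sum_mono) (use fail in \<open>auto simp: Y_def\<close>)
    finally have le: "(\<Sum>w\<in>\<Omega>. real (card {x \<in> Y. \<not> sat x w})) \<le> (\<Sum>w\<in>\<Omega>. \<delta> * card Y)"
      by (simp add: mult_ac)
    obtain w where w: "w \<in> \<Omega>" "real (card {x \<in> Y. \<not> sat x w}) \<le> \<delta> * card Y"
    proof (rule ccontr)
      assume "\<not> thesis"
      then have "\<And>w. w \<in> \<Omega> \<Longrightarrow> \<delta> * card Y < real (card {x \<in> Y. \<not> sat x w})"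
        using that by (meson not_le)
      then have "(\<Sum>w\<in>\<Omega>. \<delta> * card Y) < (\<Sum>w\<in>\<Omega>. real (card {x \<in> Y. \<not> sat x w}))"
        by (intro sum_strict_mono) (use fin ne in auto)
      then show False using le by simp
    qed
    have "{x \<in> X. \<forall>v\<in>insert w F. \<not> sat x v} = {x \<in> Y. \<not> sat x w}" by (auto simp: Y_def)
    moreover have "\<delta> * card Y \<le> card X * \<delta> ^ Suc n"
      using mult_left_mono[OF F(3) \<open>\<delta> \<ge> 0\<close>] by (simp add: Y_def mult_ac)
    moreover have "card (insert w F) \<le> Suc n" using F(2) card_insert_le_m1[of "Suc n" F w] by simp
    ultimately show ?case using w F(1) by (intro exI[of _ "insert w F"]) auto
  qed
  then obtain F where F: "F \<subseteq> \<Omega>" "card F \<le> M"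
    "real (card {x \<in> X. \<forall>w\<in>F. \<not> sat x w}) \<le> card X * \<delta> ^ M" by blast
  then have "card {x \<in> X. \<forall>w\<in>F. \<not> sat x w} = 0" using small by linarith
  then have "{x \<in> X. \<forall>w\<in>F. \<not> sat x w} = {}" using fin by simp
  then have "\<exists>w\<in>F. sat x w" if "x \<in> X" for x using that by blast
  then show ?thesis by (rule that[OF F(1,2)])
qed

lemma card_PiE_const_on:
  assumes "finite P" "T \<subseteq> P"
  shows "card (Pi\<^sub>E P (\<lambda>q. if q \<in> T then G else V)) = card G ^ card T * card V ^ (card P - card T)"
proof -
  have "card (Pi\<^sub>E P (\<lambda>q. if q \<in> T then G else V)) = (\<Prod>q\<in>P. if q \<in> T then card G else card V)"
    using assms by (simp add: card_PiE if_distrib[of card])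
  also have "\<dots> = (\<Prod>q\<in>T. card G) * (\<Prod>q\<in>P - T. card V)"
    using assms by (subst prod.If_cases) (auto simp: Int_absorb1 Diff_eq[symmetric])
  finally show ?thesis using assms by (simp add: card_Diff_subset finite_subset)
qed

text \<open>Union bound over the \<open>g\<close>-element sets \<open>G\<close> of colours that
  contain the image of \<open>T\<close>; there are at most \<open>m ^ g\<close> of them.\<close>

lemma card_small_image_PiE:
  assumes "finite P" "T \<subseteq> P" "g \<le> m"
  shows "card {h \<in> P \<rightarrow>\<^sub>E {..<m}. card (h ` T) \<le> g} \<le> m ^ g * (g ^ card T * m ^ (card P - card T))"
proof -
  let ?G = "{G. G \<subseteq> {..<m} \<and> card G = g}"
  have "{h \<in> P \<rightarrow>\<^sub>E {..<m}. card (h ` T) \<le> g} \<subseteq>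
      (\<Union>G\<in>?G. Pi\<^sub>E P (\<lambda>q. if q \<in> T then G else {..<m}))"
  proof
    fix h assume h: "h \<in> {h \<in> P \<rightarrow>\<^sub>E {..<m}. card (h ` T) \<le> g}"
    then have "h ` T \<subseteq> {..<m}" using assms by auto
    then obtain G where "h ` T \<subseteq> G" "G \<subseteq> {..<m}" "card G = g"
      using exists_subset_between[of "h ` T" g "{..<m}"] h assms(3) by auto
    then show "h \<in> (\<Union>G\<in>?G. Pi\<^sub>E P (\<lambda>q. if q \<in> T then G else {..<m}))"
      using h by (intro UN_I[of G]) (auto simp: PiE_iff)
  qed
  moreover have "finite (Pi\<^sub>E P (\<lambda>q. if q \<in> T then G else {..<m}))" if "G \<in> ?G" for G
    using that assms(1) finite_subset[of G "{..<m}"] by (intro finite_PiE) auto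
  ultimately have "card {h \<in> P \<rightarrow>\<^sub>E {..<m}. card (h ` T) \<le> g} \<le>
      card (\<Union>G\<in>?G. Pi\<^sub>E P (\<lambda>q. if q \<in> T then G else {..<m}))"
    by (intro card_mono finite_UN_I) simp_all
  also have "\<dots> \<le> (\<Sum>G\<in>?G. card (Pi\<^sub>E P (\<lambda>q. if q \<in> T then G else {..<m})))"
    by (rule card_UN_le) simp
  also have "\<dots> = card ?G * (g ^ card T * m ^ (card P - card T))"
    using assms by (simp add: card_PiE_const_on)
  also have "\<dots> \<le> m ^ g * (g ^ card T * m ^ (card P - card T))"
    using assms by (intro mult_right_mono) (simp_all add: n_subsets binomial_le_pow)
  finally show ?thesis .
qed

text \<open>This is \<open>(1 + 1 / s) ^ k \<le> (1 + 1 / s) ^ s \<le> exp 1 \<le> 3\<close>. It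
  bounds below by 1/3 the chance that \<open>k\<close> randomly coloured points all avoid one of
  \<open>s + 1\<close> colours.\<close>

lemma power_Suc_le_3_power:
  assumes "k \<le> s"
  shows "Suc s ^ k \<le> 3 * s ^ k"
proof (cases "s = 0")
  case False
  have "(1 + 1 / real s) ^ k \<le> exp (1 / real s) ^ k"
    by (intro power_mono exp_ge_add_one_self) simp
  also have "\<dots> \<le> exp (1 / real s) ^ s"
    using assms by (intro power_increasing) simp_all
  also have "\<dots> = exp 1" using False by (simp add: exp_of_nat_mult[symmetric])
  finally have "(1 + 1 / real s) ^ k \<le> 3" using exp_le by linarith
  then have "(1 + 1 / real s) ^ k * real s ^ k \<le> 3 * real s ^ k"
    by (intro mult_right_mono) simp_all
  moreover have "(1 + 1 / real s) * real s = real (Suc s)" using False by (simp add: field_simps)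
  ultimately have "real (Suc s) ^ k \<le> 3 * real s ^ k" by (simp only: power_mult_distrib[symmetric])
  then have "real (Suc s ^ k) \<le> real (3 * s ^ k)" by simp
  then show ?thesis by (simp only: of_nat_le_iff)
qed (use assms in simp)

text \<open>In a random colouring with \<open>t\<close> colours, \<open>p\<close> gets colour 0 with
  probability \<open>1 / t\<close>, and the at most \<open>t - 1\<close> other points of
  \<open>T\<close> avoid that colour with probability at least 1/3. The inequality is stated without
  denominators.\<close>

lemma card_isolating_PiE:
  assumes "finite P" "T \<subseteq> P" "p \<in> T" "card T \<le> t"
  shows "t ^ card P \<le> 3 * t * card {h \<in> P \<rightarrow>\<^sub>E {..<t}. {q \<in> P. h q = 0} \<inter> T = {p}}"
proof -
  have finT: "finite T" using assms finite_subset by blast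
  obtain s where t: "t = Suc s" using assms finT by (metis card_0_eq empty_iff le_zero_eq not0_implies_Suc)
  have cT: "card T = Suc (card (T - {p}))" using finT assms(3) by (rule card.remove)
  \<comment> \<open>The colourings wanted form a box, so they are counted by a product over
    \<open>P\<close>.\<close>
  let ?V = "\<lambda>q. if q \<in> T then if q = p then {0} else {1..<t} else {..<t}"
  have "card (Pi\<^sub>E P ?V) = (\<Prod>q\<in>P. card (?V q))" using assms by (simp add: card_PiE)
  also have "\<dots> = (\<Prod>q\<in>T. card (?V q)) * (\<Prod>q\<in>P - T. card (?V q))"
    using assms by (simp add: prod.subset_diff mult.commute)
  also have "(\<Prod>q\<in>T. card (?V q)) = (\<Prod>q\<in>T - {p}. card (?V q))"
    using finT assms(3) by (simp add: prod.remove)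
  also have "\<dots> = s ^ card (T - {p})" by (simp add: t)
  also have "(\<Prod>q\<in>P - T. card (?V q)) = t ^ (card P - card T)"
    using assms finT by (simp add: card_Diff_subset)
  finally have c: "card (Pi\<^sub>E P ?V) = s ^ card (T - {p}) * t ^ (card P - card T)" .
  have "card P = Suc (card (T - {p}) + (card P - card T))"
    using cT card_mono[OF assms(1,2)] by simp
  then have "t ^ card P = t * (t ^ card (T - {p}) * t ^ (card P - card T))"
    by (metis power_Suc power_add)
  also have "\<dots> \<le> t * (3 * s ^ card (T - {p}) * t ^ (card P - card T))"
    unfolding t by (intro mult_left_mono mult_right_mono power_Suc_le_3_power)
      (use assms(4) cT t in auto)
  also have "\<dots> = 3 * t * card (Pi\<^sub>E P ?V)" by (simp only: c mult_ac)
  also have "\<dots> \<le> 3 * t * card {h \<in> P \<rightarrow>\<^sub>E {..<t}. {q \<in> P. h q = 0} \<inter> T = {p}}"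
  proof (intro mult_left_mono card_mono)
    show "Pi\<^sub>E P ?V \<subseteq> {h \<in> P \<rightarrow>\<^sub>E {..<t}. {q \<in> P. h q = 0} \<inter> T = {p}}"
    proof
      fix h assume h: "h \<in> Pi\<^sub>E P ?V"
      have hV: "h q \<in> ?V q" if "q \<in> P" for q using h that by (rule PiE_mem)
      have "h p = 0" using hV[of p] assms by auto
      moreover have "q = p" if "q \<in> T" "h q = 0" for q
        using hV[of q] that assms by (auto split: if_splits)
      moreover have "h \<in> P \<rightarrow>\<^sub>E {..<t}"
        using hV h t by (intro PiE_I) (fastforce simp: PiE_iff extensional_def split: if_splits)+
      ultimately show "h \<in> {h \<in> P \<rightarrow>\<^sub>E {..<t}. {q \<in> P. h q = 0} \<inter> T = {p}}"
        using assms(2,3) by blast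
    qed
    show "finite {h \<in> P \<rightarrow>\<^sub>E {..<t}. {q \<in> P. h q = 0} \<inter> T = {p}}"
      by (rule finite_subset[OF _ finite_PiE[of P "\<lambda>_. {..<t}"]]) (use assms in auto)
  qed simp_all
  finally show ?thesis .
qed

lemma isolating_family:
  fixes P :: "'a set"
  assumes "finite P" "t > 0" "real (card P) ^ t * (1 - 1 / (3 * real t)) ^ M < 1"
  shows "\<exists>\<S>\<subseteq>Pow P. card \<S> \<le> M \<and>
    (\<forall>T p. T \<subseteq> P \<longrightarrow> card T \<le> t \<longrightarrow> p \<in> T \<longrightarrow> (\<exists>S\<in>\<S>. S \<inter> T = {p}))"
proof -
  \<comment> \<open>A pair \<open>(T, p)\<close> is coded by a list of length exactly
    \<open>t\<close> with entry set \<open>T\<close> and head \<open>p\<close>, so the union bound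
    runs over \<open>card P ^ t\<close> events.\<close>
  let ?X = "{xs. set xs \<subseteq> P \<and> length xs = t}" and ?\<Omega> = "P \<rightarrow>\<^sub>E {..<t}"
  let ?Z = "\<lambda>h. {q \<in> P. h q = 0}"
  obtain F where F: "F \<subseteq> ?\<Omega>" "card F \<le> M"
    "\<And>xs. xs \<in> ?X \<Longrightarrow> \<exists>h\<in>F. ?Z h \<inter> set xs = {hd xs}"
  proof (rule greedy_cover[of ?X ?\<Omega> "1 - 1 / (3 * real t)"
        "\<lambda>xs h. ?Z h \<inter> set xs = {hd xs}" M])
    show "finite ?X" using assms by (intro finite_lists_length_eq)
    show "finite ?\<Omega>" using assms by (intro finite_PiE) auto
    show "?\<Omega> \<noteq> {}" using \<open>t > 0\<close> by (simp add: PiE_eq_empty_iff lessThan_empty_iff)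
    show "0 \<le> 1 - 1 / (3 * real t)" using \<open>t > 0\<close> by (simp add: field_simps)
    show "real (card ?X) * (1 - 1 / (3 * real t)) ^ M < 1"
      using assms by (simp add: card_lists_length_eq)
    fix xs assume xs: "xs \<in> ?X"
    let ?W = "{h \<in> ?\<Omega>. ?Z h \<inter> set xs = {hd xs}}"
    have "t ^ card P \<le> 3 * t * card ?W"
      using xs assms by (intro card_isolating_PiE) (auto simp: card_length)
    then have "real (t ^ card P) \<le> real (3 * t * card ?W)" by (simp only: of_nat_le_iff)
    then have "real (t ^ card P) / (3 * real t) \<le> card ?W" using \<open>t > 0\<close> by (simp add: field_simps)
    moreover have cO: "card ?\<Omega> = t ^ card P" using assms by (simp add: card_PiE)
    moreover have "card ?W + card {h \<in> ?\<Omega>. ?Z h \<inter> set xs \<noteq> {hd xs}} = card ?\<Omega>"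
      using \<open>finite ?\<Omega>\<close> by (subst card_Un_disjoint[symmetric]) (auto intro!: arg_cong[of _ _ card])
    ultimately show "real (card {h \<in> ?\<Omega>. ?Z h \<inter> set xs \<noteq> {hd xs}}) \<le> (1 - 1 / (3 * real t)) * card ?\<Omega>"
      by (simp add: algebra_simps flip: of_nat_power)
  qed auto
  show ?thesis
  proof (intro exI[of _ "?Z ` F"] conjI allI impI)
    show "?Z ` F \<subseteq> Pow P" by auto
    have "finite F" using finite_subset[OF F(1)] assms by (simp add: finite_PiE)
    then show "card (?Z ` F) \<le> M" using F(2) card_image_le le_trans by blast
    fix T p assume T: "T \<subseteq> P" "card T \<le> t" "p \<in> T"
    have finT: "finite T" using T assms finite_subset by blast
    obtain ys where ys: "set ys = T" "distinct ys" using finite_distinct_list[OF finT] by blast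
    \<comment> \<open>Extra copies of \<open>p\<close> pad the list to length \<open>t\<close>
      without changing its set of entries.\<close>
    define xs where "xs = p # remove1 p ys @ replicate (t - card T) p"
    have "set xs = T" using T ys by (auto simp: xs_def)
    moreover have "length ys = card T" using ys distinct_card by fastforce
    moreover have "card T > 0" using T finT by (auto simp: card_gt_0_iff)
    ultimately have "xs \<in> ?X" using T ys by (auto simp: xs_def length_remove1)
    then obtain h where "h \<in> F" "?Z h \<inter> set xs = {hd xs}" using F(3) by blast
    then show "\<exists>S\<in>?Z ` F. S \<inter> T = {p}" using \<open>set xs = T\<close> by (auto simp: xs_def)
  qed
qed

text \<open>With \<open>m = 3 * g\<^sup>2\<close> colours, a set of \<open>2 * g\<close> points
  receives at most \<open>g\<close> colours with probability at most \<open>m ^ g * (g / m) ^ (2 *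
  g) = (g\<^sup>2 / m) ^ g = (1 / 3) ^ g\<close>.\<close>

lemma spreading_family:
  fixes B :: "'a set"
  assumes "finite B" "g > 0" "real (card B) ^ (2 * g) * ((1 / 3) ^ g) ^ M < 1"
  shows "\<exists>H\<subseteq>B \<rightarrow>\<^sub>E {..<3 * g\<^sup>2}. card H \<le> M \<and>
    (\<forall>T. T \<subseteq> B \<longrightarrow> card T = 2 * g \<longrightarrow> (\<exists>h\<in>H. g < card (h ` T)))"
proof -
  define m where "m = 3 * g\<^sup>2"
  have m: "m > 0" "g \<le> m" using \<open>g > 0\<close> by (auto simp: m_def power2_eq_square)
  let ?X = "{T. T \<subseteq> B \<and> card T = 2 * g}" and ?\<Omega> = "B \<rightarrow>\<^sub>E {..<m}"
  obtain F where F: "F \<subseteq> ?\<Omega>" "card F \<le> M" "\<And>T. T \<in> ?X \<Longrightarrow> \<exists>h\<in>F. g < card (h ` T)"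
  proof (rule greedy_cover[of ?X ?\<Omega> "(1 / 3) ^ g" "\<lambda>T h. g < card (h ` T)" M])
    show "finite ?X" using assms by simp
    show "finite ?\<Omega>" using assms by (intro finite_PiE) auto
    show "?\<Omega> \<noteq> {}" using m by (simp add: PiE_eq_empty_iff lessThan_empty_iff)
    have "card ?X \<le> card B ^ (2 * g)"
      using assms by (cases "2 * g \<le> card B") (simp_all add: n_subsets binomial_le_pow binomial_eq_0)
    then have "real (card ?X) \<le> real (card B) ^ (2 * g)" by (metis of_nat_le_iff of_nat_power)
    then have "real (card ?X) * ((1 / 3) ^ g) ^ M \<le> real (card B) ^ (2 * g) * ((1 / 3) ^ g) ^ M"
      by (intro mult_right_mono) simp_all
    then show "real (card ?X) * ((1 / 3) ^ g) ^ M < 1" using assms(3) by linarith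
    fix T assume T: "T \<in> ?X"
    have "card B = (card B - 2 * g) + (g + g)" using T card_mono[OF assms(1), of T] by simp
    then have "m ^ card B = m ^ (card B - 2 * g) * (m ^ g * m ^ g)"
      by (metis power_add)
    also have "m ^ g * m ^ g = 3 ^ g * (m ^ g * g ^ (2 * g))"
      by (simp add: m_def power_mult_distrib mult_ac flip: power_mult)
    finally have e: "m ^ card B = 3 ^ g * (m ^ g * (g ^ (2 * g) * m ^ (card B - 2 * g)))"
      by (simp only: mult_ac)
    have "card {h \<in> ?\<Omega>. card (h ` T) \<le> g} \<le> m ^ g * (g ^ (2 * g) * m ^ (card B - 2 * g))"
      using card_small_image_PiE[of B T g m] assms m T by simp
    then have "3 ^ g * card {h \<in> ?\<Omega>. card (h ` T) \<le> g} \<le> card ?\<Omega>"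
      using assms by (simp add: card_PiE e)
    then have "real (3 ^ g * card {h \<in> ?\<Omega>. card (h ` T) \<le> g}) \<le> real (card ?\<Omega>)"
      by (simp only: of_nat_le_iff)
    then show "real (card {h \<in> ?\<Omega>. \<not> g < card (h ` T)}) \<le> (1 / 3) ^ g * real (card ?\<Omega>)"
      by (simp add: not_less field_simps)
  qed auto
  show ?thesis by (intro exI[of _ F] conjI allI impI) (use F in \<open>simp_all add: m_def\<close>)
qed

subsection \<open>Parts of an integer supported on a set of primes\<close>

definition prime_part :: "nat set \<Rightarrow> nat \<Rightarrow> nat" where
  "prime_part S n = (\<Prod>p\<in>S. p ^ multiplicity p n)"

lemma prime_part_pos: "(\<And>p. p \<in> S \<Longrightarrow> prime p) \<Longrightarrow> prime_part S n > 0"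
  unfolding prime_part_def by (intro prod_pos zero_less_power) (auto simp: prime_gt_0_nat)

lemma prime_part_dvd_mono: "a dvd b \<Longrightarrow> b > 0 \<Longrightarrow> prime_part S a dvd prime_part S b"
  unfolding prime_part_def
  by (intro prod_dvd_prod le_imp_power_dvd dvd_imp_multiplicity_le) auto

lemma multiplicity_prime_part:
  assumes "finite S" "\<And>p. p \<in> S \<Longrightarrow> prime p" "prime p"
  shows "multiplicity p (prime_part S n) = (if p \<in> S then multiplicity p n else 0)"
  unfolding prime_part_def using assms by (intro multiplicity_prod_prime_powers) auto

lemma prime_part_eqD:
  assumes "prime_part S a = prime_part S b" "finite S" "\<And>p. p \<in> S \<Longrightarrow> prime p" "p \<in> S"
  shows "multiplicity p a = multiplicity p b"
  using multiplicity_prime_part[of S p a] multiplicity_prime_part[of S p b] assms by simp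

lemma prime_part_le:
  assumes "finite S" "\<And>p. p \<in> S \<Longrightarrow> prime p" "n > 0"
  shows "prime_part S n \<le> n"
proof -
  have "prime_part S n dvd n"
    by (rule multiplicity_le_imp_dvd)
      (use assms prime_part_pos[of S n] in \<open>auto simp: multiplicity_prime_part\<close>)
  then show ?thesis using assms by (intro dvd_imp_le) auto
qed

lemma prime_part_eq_self:
  assumes "finite S" "prime_factors n \<subseteq> S" "\<And>p. p \<in> S \<Longrightarrow> prime p" "n > 0"
  shows "prime_part S n = n"
proof -
  have "prime_part S n = (\<Prod>p\<in>prime_factors n. p ^ multiplicity p n)"
    unfolding prime_part_def
  proof (rule prod.mono_neutral_right)
    show "\<forall>p\<in>S - prime_factors n. p ^ multiplicity p n = 1"
      using assms by (auto simp: prime_factors_multiplicity)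
  qed (use assms in auto)
  then show ?thesis using prime_factorization_nat[OF \<open>n > 0\<close>] by simp
qed

text \<open>The quotient of the two \<open>S\<close>-parts is an integer other than 1. A prime
  divisor of it divides the \<open>S\<close>-part of \<open>b\<close>, hence belongs to
  \<open>S\<close> and is at least \<open>y\<close>.\<close>

lemma prime_part_ge_mult:
  assumes "a dvd b" "b > 0" "finite S" "\<And>p. p \<in> S \<Longrightarrow> prime p" "\<And>p. p \<in> S \<Longrightarrow> y \<le> real p"
    and ne: "prime_part S a \<noteq> prime_part S b"
  shows "y * real (prime_part S a) \<le> real (prime_part S b)"
proof -
  obtain k where k: "prime_part S b = prime_part S a * k"
    using prime_part_dvd_mono[OF assms(1,2)] by (auto simp: dvd_def)
  have "k > 0" using k prime_part_pos[of S b] assms by (cases k) auto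
  have "k \<noteq> 1" using k ne by auto
  then obtain q where q: "prime q" "q dvd k" using prime_factor_nat by blast
  then have "q dvd (\<Prod>p\<in>S. p ^ multiplicity p b)" using k by (simp add: prime_part_def[symmetric])
  then obtain p where "p \<in> S" "q dvd p ^ multiplicity p b"
    using q assms by (auto simp: prime_dvd_prod_iff)
  then have "q = p" using q assms by (metis prime_dvd_power primes_dvd_imp_eq)
  then have "y \<le> real q" using assms \<open>p \<in> S\<close> by blast
  also have "\<dots> \<le> real k" using q \<open>k > 0\<close> by (simp add: dvd_imp_le)
  finally have "y * real (prime_part S a) \<le> real k * real (prime_part S a)"
    by (intro mult_right_mono) auto
  then show ?thesis by (simp add: k mult.commute)
qed

text \<open>This is how isolation is used: when \<open>p\<close> is the only prime of
  \<open>S\<close> at which the multiplicities differ, the factor at \<open>p\<close> decides the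
  comparison.\<close>

lemma prime_part_less:
  assumes "finite S" "\<And>p. p \<in> S \<Longrightarrow> prime p" "p \<in> S" "multiplicity p b < multiplicity p a"
    and eq: "\<And>q. q \<in> S \<Longrightarrow> q \<noteq> p \<Longrightarrow> multiplicity q b = multiplicity q a"
  shows "prime_part S b < prime_part S a"
proof -
  have "prime_part S n = p ^ multiplicity p n * prime_part (S - {p}) n" for n
    unfolding prime_part_def using assms by (simp add: prod.remove)
  moreover have "prime_part (S - {p}) b = prime_part (S - {p}) a"
    unfolding prime_part_def using eq by (intro prod.cong) auto
  moreover have "p ^ multiplicity p b < p ^ multiplicity p a"
    using assms prime_gt_1_nat by (intro power_strict_increasing) auto
  moreover have "prime_part (S - {p}) a > 0" using assms by (intro prime_part_pos) auto
  ultimately show ?thesis by simp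
qed

lemma prime_part_Un:
  "finite S \<Longrightarrow> finite T \<Longrightarrow> S \<inter> T = {} \<Longrightarrow> prime_part (S \<union> T) n = prime_part S n * prime_part T n"
  unfolding prime_part_def by (rule prod.union_disjoint)

lemma prime_part_fibres:
  fixes h :: "nat \<Rightarrow> nat"
  assumes "finite B" "h ` B \<subseteq> {..<m}"
  shows "prime_part B n = (\<Prod>j<m. prime_part {p \<in> B. h p = j} n)"
  unfolding prime_part_def using assms by (intro prod.group[symmetric]) auto

text \<open>
  When \<open>n < c\<close>, the second summand is less than \<open>1\<close> and reverses the order of the \<open>S\<close>-parts within a
  level.
\<close>

definition shifted_level :: "real \<Rightarrow> nat \<Rightarrow> nat set \<Rightarrow> real \<Rightarrow> nat \<Rightarrow> real" where
  "shifted_level y c S \<theta> n =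
     of_int \<lfloor>ln (real (prime_part S n)) / ln y + \<theta>\<rfloor> - real (prime_part S n) / real c"

text \<open>Distinct \<open>S\<close>-parts differ by a factor of at least \<open>y\<close>, which
  raises the level by at least 1. The term subtracted for \<open>b\<close> stays below 1 and cannot
  undo this.\<close>

lemma shifted_level_mono:
  assumes "a dvd b" "b > 0" "b < c" "finite S" "y > 1"
    and S: "\<And>p. p \<in> S \<Longrightarrow> prime p" "\<And>p. p \<in> S \<Longrightarrow> y \<le> real p"
  shows "shifted_level y c S \<theta> a \<le> shifted_level y c S \<theta> b"
proof (cases "prime_part S a = prime_part S b")
  case False
  have pos: "prime_part S a > 0" "prime_part S b > 0" using S(1) by (auto intro!: prime_part_pos)
  have "ln (y * real (prime_part S a)) \<le> ln (real (prime_part S b))"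
    using prime_part_ge_mult[OF assms(1,2,4) S False] pos \<open>y > 1\<close> by simp
  then have "ln y + ln (real (prime_part S a)) \<le> ln (real (prime_part S b))"
    using pos \<open>y > 1\<close> by (simp add: ln_mult)
  then have "(ln y + ln (real (prime_part S a))) / ln y \<le> ln (real (prime_part S b)) / ln y"
    using \<open>y > 1\<close> by (intro divide_right_mono) auto
  then have "ln (real (prime_part S a)) / ln y + 1 \<le> ln (real (prime_part S b)) / ln y"
    using \<open>y > 1\<close> by (simp add: add_divide_distrib)
  then have "\<lfloor>ln (real (prime_part S a)) / ln y + \<theta>\<rfloor> + 1 \<le> \<lfloor>ln (real (prime_part S b)) / ln y + \<theta>\<rfloor>"
    by linarith
  moreover have "real (prime_part S b) / real c < 1"
    using prime_part_le[of S b] assms S(1) by (simp add: field_simps)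
  moreover have "real (prime_part S a) / real c \<ge> 0" by simp
  ultimately show ?thesis unfolding shifted_level_def by linarith
qed (simp add: shifted_level_def)

text \<open>The subtracted term favours the smaller \<open>S\<close>-part, so the two inequalities
  force the level to rise strictly for both shifts. Hence both an integer and an integer plus 1/2
  lie between \<open>u\<close> and \<open>v\<close>, which are therefore at least 1/2 apart.\<close>

lemma shifted_level_gap:
  assumes "c > 0" "y > 1" "prime_part S a < prime_part S b"
    and "shifted_level y c S 0 a \<le> shifted_level y c S 0 b"
    and "shifted_level y c S (1 / 2) a \<le> shifted_level y c S (1 / 2) b"
  shows "ln y / 2 \<le> ln (real (prime_part S b)) - ln (real (prime_part S a))"
proof -
  define u v where "u = ln (real (prime_part S a)) / ln y" and "v = ln (real (prime_part S b)) / ln y"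
  have "real (prime_part S a) / real c < real (prime_part S b) / real c"
    using assms by (intro divide_strict_right_mono) auto
  then have "\<lfloor>u\<rfloor> < \<lfloor>v\<rfloor>" "\<lfloor>u + 1 / 2\<rfloor> < \<lfloor>v + 1 / 2\<rfloor>"
    using assms(4,5) unfolding shifted_level_def u_def v_def by auto
  then have "u + 1 / 2 \<le> v" by (cases "\<lfloor>u + 1 / 2\<rfloor> \<le> \<lfloor>u\<rfloor>") linarith+
  then have "(u + 1 / 2) * ln y \<le> v * ln y" using \<open>y > 1\<close> by (intro mult_right_mono) auto
  then show ?thesis using \<open>y > 1\<close> by (simp add: u_def v_def distrib_right)
qed

subsection \<open>The dimension of an interval\<close>

lemma mem_intervalD:
  assumes "\<kappa> > 0" "N > 0" "n \<in> {n. real N / \<kappa> \<le> real n \<and> real n \<le> real N}"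
  shows "n > 0" "n \<le> N"
proof -
  have "0 < real N / \<kappa>" using assms(1,2) by simp
  also have "\<dots> \<le> real n" using assms(3) by simp
  finally show "n > 0" by simp
  show "n \<le> N" using assms(3) by simp
qed

lemma finite_interval: "finite {n. x \<le> real n \<and> real n \<le> real N}"
  by (rule finite_subset[of _ "{..N}"]) auto

text \<open>The quotient \<open>b / a\<close> is at most \<open>\<kappa>\<close>, so no prime above
  \<open>\<kappa>\<close> divides it.\<close>

lemma prime_part_rough_eq:
  assumes "\<kappa> > 0" "N > 0" "a dvd b"
    and "a \<in> {n. real N / \<kappa> \<le> real n \<and> real n \<le> real N}"
    and "b \<in> {n. real N / \<kappa> \<le> real n \<and> real n \<le> real N}"
    and Q: "finite Q" "\<And>p. p \<in> Q \<Longrightarrow> prime p" "\<And>p. p \<in> Q \<Longrightarrow> \<kappa> < real p"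
  shows "prime_part Q a = prime_part Q b"
  unfolding prime_part_def
proof (rule prod.cong)
  fix p assume p: "p \<in> Q"
  note pos = mem_intervalD[OF assms(1,2,4)] mem_intervalD[OF assms(1,2,5)]
  obtain k where k: "b = a * k" using \<open>a dvd b\<close> by (auto simp: dvd_def)
  have "k > 0" using k pos by (cases k) auto
  have "real N \<le> \<kappa> * real a" using assms by (auto simp: field_simps)
  moreover have "real (a * k) \<le> real N" using pos(4) k by (simp only: of_nat_le_iff)
  ultimately have "real a * real k \<le> real a * \<kappa>" by (simp add: mult.commute)
  then have "real k \<le> \<kappa>" using pos(1) by (simp only: mult_le_cancel_left_pos of_nat_0_less_iff)
  then have "k < p" using Q(3)[OF p] by linarith
  then have "\<not> p dvd k" using \<open>k > 0\<close> by (auto dest: dvd_imp_le)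
  then have "multiplicity p b = multiplicity p a"
    using k pos \<open>k > 0\<close> Q(2)[OF p]
    by (simp add: prime_elem_multiplicity_mult_distrib not_dvd_imp_multiplicity_0)
  then show "p ^ multiplicity p a = p ^ multiplicity p b" by simp
qed simp

text \<open>The \<open>S\<close>-part itself fixes the direction in which \<open>S\<close>-parts may
  change; the two levels, which reverse ties, then force any change to be by a factor of at least
  \<open>sqrt y\<close>.\<close>

definition level_family :: "real \<Rightarrow> nat \<Rightarrow> nat set \<Rightarrow> (nat \<Rightarrow> real) set" where
  "level_family y c S =
     {\<lambda>n. real (prime_part S n), shifted_level y c S 0, shifted_level y c S (1 / 2)}"

lemma card_level_family: "finite (level_family y c S)" "card (level_family y c S) \<le> 3"
  by (simp_all add: level_family_def card_insert_le_m1)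

lemma level_family_mono:
  assumes "f \<in> level_family y c S" "a dvd b" "b > 0" "b < c" "finite S" "y > 1"
    and "\<And>p. p \<in> S \<Longrightarrow> prime p" "\<And>p. p \<in> S \<Longrightarrow> y \<le> real p"
  shows "f a \<le> f b"
  using assms(1) unfolding level_family_def
proof (elim insertE emptyE)
  assume "f = (\<lambda>n. real (prime_part S n))"
  then show ?thesis
    using dvd_imp_le[OF prime_part_dvd_mono[OF assms(2,3)] prime_part_pos[of S b]] assms(7) by simp
qed (use shifted_level_mono[OF assms(2-8)] in simp_all)

lemma level_family_gap:
  assumes "\<And>f. f \<in> level_family y c S \<Longrightarrow> f a \<le> f b" "c > 0" "y > 1"
    and "finite S" "\<And>p. p \<in> S \<Longrightarrow> prime p"
  shows "0 \<le> ln (real (prime_part S b)) - ln (real (prime_part S a))"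
    and "\<exists>p\<in>S. multiplicity p a \<noteq> multiplicity p b \<Longrightarrow>
      ln y / 2 \<le> ln (real (prime_part S b)) - ln (real (prime_part S a))"
proof -
  have le: "prime_part S a \<le> prime_part S b"
    using assms(1)[of "\<lambda>n. real (prime_part S n)"] by (simp add: level_family_def)
  then show "0 \<le> ln (real (prime_part S b)) - ln (real (prime_part S a))"
    using prime_part_pos[of S a] assms(5) by simp
  assume "\<exists>p\<in>S. multiplicity p a \<noteq> multiplicity p b"
  then have "prime_part S a \<noteq> prime_part S b" using prime_part_eqD[OF _ assms(4,5)] by blast
  then show "ln y / 2 \<le> ln (real (prime_part S b)) - ln (real (prime_part S a))"
    using le assms by (intro shifted_level_gap[of c]) (auto simp: level_family_def)
qed

lemma ln_prime_part_Un:
  assumes "finite S" "finite T" "S \<inter> T = {}" "\<And>p. p \<in> S \<union> T \<Longrightarrow> prime p"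
  shows "ln (real (prime_part (S \<union> T) n)) = ln (real (prime_part S n)) + ln (real (prime_part T n))"
proof -
  have "prime_part S n > 0" "prime_part T n > 0" using assms(4) by (auto intro!: prime_part_pos)
  then show ?thesis using prime_part_Un[OF assms(1-3), of n] by (simp add: ln_mult)
qed

lemma ln_prime_part_fibres:
  fixes h :: "nat \<Rightarrow> nat"
  assumes "finite B" "h ` B \<subseteq> {..<m}" "\<And>p. p \<in> B \<Longrightarrow> prime p"
  shows "ln (real (prime_part B n)) = (\<Sum>j<m. ln (real (prime_part {p \<in> B. h p = j} n)))"
proof -
  have pos: "prime_part {p \<in> B. h p = j} n > 0" for j using assms(3) by (auto intro!: prime_part_pos)
  have "ln (real (prime_part B n)) = ln (\<Prod>j<m. real (prime_part {p \<in> B. h p = j} n))"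
    using prime_part_fibres[OF assms(1,2), of n] by simp
  also have "\<dots> = (\<Sum>j<m. ln (real (prime_part {p \<in> B. h p = j} n)))"
    by (rule ln_prod) (use pos in auto)
  finally show ?thesis .
qed

text \<open>The bound counts 2 functions for the rough part, 3 for the block \<open>A\<close>, one
  for each set in \<open>\<S>\<close> and 3 for each fibre. By \<open>card_le\<close>, a set of more
  than \<open>t\<close> primes has at least \<open>2 * g\<close> members in \<open>B\<close>; by
  \<open>gap\<close>, the budget \<open>ln \<kappa>\<close> cannot pay for \<open>g + 1\<close>
  fibres.\<close>

lemma poset_dim_divisibility_le:
  fixes \<kappa> y :: real and N :: nat
  assumes "\<kappa> > 1" "N > 0" "y > 1"
  defines "R \<equiv> {n. real N / \<kappa> \<le> real n \<and> real n \<le> real N}"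
    and "P \<equiv> {p. prime p \<and> real p \<le> \<kappa>}"
  defines "A \<equiv> {p \<in> P. real p \<le> y}" and "B \<equiv> {p \<in> P. y < real p}"
  assumes card_le: "card A + 2 * g \<le> t"
    and iso: "\<S> \<subseteq> Pow P" "\<And>T p. T \<subseteq> P \<Longrightarrow> card T \<le> t \<Longrightarrow> p \<in> T \<Longrightarrow> \<exists>S\<in>\<S>. S \<inter> T = {p}"
    and spread: "finite H" "H \<subseteq> B \<rightarrow>\<^sub>E {..<m}"
      "\<And>T. T \<subseteq> B \<Longrightarrow> card T = 2 * g \<Longrightarrow> \<exists>h\<in>H. g < card (h ` T)"
    and gap: "ln \<kappa> < real (g + 1) * (ln y / 2)"
  shows "poset_dim R (divisibility_order R) \<le> 5 + card \<S> + 3 * (card H * m)"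
proof -
  \<comment> \<open>The bound by \<open>N\<close> keeps \<open>Q\<close> finite, while
    \<open>P\<close> and \<open>Q\<close> together still contain every prime factor of every member
    of \<open>R\<close>.\<close>
  define Q where "Q = {p. prime p \<and> \<kappa> < real p \<and> p \<le> N}"
  define fib where "fib h j = {p \<in> B. h p = j}" for h :: "nat \<Rightarrow> nat" and j
  define \<F>0 where "\<F>0 = {\<lambda>n. real (prime_part Q n), \<lambda>n. - real (prime_part Q n)}"
  define \<F>1 where "\<F>1 = (\<lambda>S n. real (prime_part S n)) ` \<S>"
  define \<F>2 where "\<F>2 = (\<Union>h\<in>H. \<Union>j<m. level_family y (Suc N) (fib h j))"
  \<comment> \<open>Base 2 is a lower bound for every prime and suits the small primes in
    \<open>A\<close>; the fibres of \<open>B\<close> use base \<open>y\<close>.\<close>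
  define \<F> where "\<F> = (\<F>0 \<union> level_family 2 (Suc N) A) \<union> \<F>1 \<union> \<F>2"
  have finP: "finite P"
  proof (rule finite_subset)
    show "P \<subseteq> {..nat \<lfloor>\<kappa>\<rfloor>}" by (auto simp: P_def le_nat_floor)
  qed simp
  have fin: "finite A" "finite B" "finite Q" "\<And>h j. finite (fib h j)" "finite \<S>"
    using finP finite_subset[OF iso(1)] by (auto simp: A_def B_def Q_def fib_def)
  have pr: "\<And>p. p \<in> P \<Longrightarrow> prime p" "\<And>p. p \<in> A \<Longrightarrow> prime p" "\<And>p. p \<in> B \<Longrightarrow> prime p"
    "\<And>p. p \<in> Q \<Longrightarrow> prime p" "\<And>h j p. p \<in> fib h j \<Longrightarrow> prime p"
    by (auto simp: P_def A_def B_def Q_def fib_def)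
  have prS: "\<And>S p. S \<in> \<S> \<Longrightarrow> p \<in> S \<Longrightarrow> prime p" using iso(1) pr(1) by blast
  have AB: "A \<union> B = P" "A \<inter> B = {}" by (auto simp: A_def B_def)
  have PQ: "P \<inter> Q = {}" by (auto simp: P_def Q_def)
  have Rpos: "n > 0" "n \<le> N" if "n \<in> R" for n
    using mem_intervalD[OF _ \<open>N > 0\<close> that[unfolded R_def]] \<open>\<kappa> > 1\<close> by simp_all
  have finR: "finite R" unfolding R_def by (rule finite_interval)
  have finF: "finite \<F>0" "finite \<F>1" "finite \<F>2"
    using fin(5) spread(1) by (auto simp: \<F>0_def \<F>1_def \<F>2_def card_level_family)
  have "card \<F>0 \<le> 2" by (simp add: \<F>0_def card_insert_le_m1)
  moreover have "card \<F>1 \<le> card \<S>" unfolding \<F>1_def using fin(5) by (rule card_image_le)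
  moreover have "card \<F>2 \<le> (\<Sum>h\<in>H. \<Sum>j<m. 3)"
    unfolding \<F>2_def using spread(1) card_level_family(2)
    by (intro order.trans[OF card_UN_le] sum_mono) auto
  moreover have "card \<F> \<le> ((card \<F>0 + card (level_family 2 (Suc N) A)) + card \<F>1) + card \<F>2"
    unfolding \<F>_def by (meson add_mono_thms_linordered_semiring(3) card_Un_le order.trans)
  ultimately have cardF: "card \<F> \<le> 5 + card \<S> + 3 * (card H * m)"
    using card_level_family(2)[of 2 "Suc N" A] by simp
  have mono: "f a \<le> f b" if f: "f \<in> \<F>" and ab: "(a, b) \<in> divisibility_order R" for f a b
  proof -
    have R: "a \<in> R" "b \<in> R" "a dvd b" using ab by (auto simp: divisibility_order_def)
    note b = Rpos[OF R(2)]
    consider "f \<in> \<F>0" | "f \<in> level_family 2 (Suc N) A" | "f \<in> \<F>1" | "f \<in> \<F>2"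
      using f unfolding \<F>_def by blast
    then show ?thesis
    proof cases
      case 1
      moreover have "prime_part Q a = prime_part Q b"
      proof (rule prime_part_rough_eq[OF _ \<open>N > 0\<close> R(3) R(1,2)[unfolded R_def] fin(3) pr(4)])
        show "\<kappa> > 0" using \<open>\<kappa> > 1\<close> by simp
        show "\<kappa> < real p" if "p \<in> Q" for p using that unfolding Q_def by blast
      qed
      ultimately show ?thesis by (auto simp: \<F>0_def)
    next
      case 2
      then show ?thesis
        by (rule level_family_mono)
          (use R b fin(1) pr(2) in \<open>auto simp: prime_ge_2_nat\<close>)
    next
      case 3
      then obtain S where S: "S \<in> \<S>" "f = (\<lambda>n. real (prime_part S n))" by (auto simp: \<F>1_def)
      then show ?thesis
        using dvd_imp_le[OF prime_part_dvd_mono[OF R(3) b(1)] prime_part_pos[of S b]] prS by simp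
    next
      case 4
      then obtain h j where "f \<in> level_family y (Suc N) (fib h j)" by (auto simp: \<F>2_def)
      then show ?thesis
        by (rule level_family_mono)
          (use R b fin(4) pr(5) \<open>y > 1\<close> in \<open>auto simp: fib_def B_def\<close>)
    qed
  qed
  have sep: "\<exists>f\<in>\<F>. f b < f a" if ab: "a \<in> R" "b \<in> R" "(a, b) \<notin> divisibility_order R" for a b
  proof (rule ccontr)
    assume "\<not> (\<exists>f\<in>\<F>. f b < f a)"
    then have le: "f a \<le> f b" if "f \<in> \<F>" for f using that by (auto simp: not_less)
    note pos = Rpos[OF ab(1)] Rpos[OF ab(2)]
    have "\<not> a dvd b" using ab by (simp add: divisibility_order_def)
    moreover have "a dvd b" if "\<And>p. prime p \<Longrightarrow> multiplicity p a \<le> multiplicity p b"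
      using pos that by (intro multiplicity_le_imp_dvd) simp_all
    ultimately obtain p where p: "prime p" "multiplicity p b < multiplicity p a"
      by (meson not_le)
    have rough: "prime_part Q a = prime_part Q b"
      using le[of "\<lambda>n. real (prime_part Q n)"] le[of "\<lambda>n. - real (prime_part Q n)"]
      by (simp add: \<F>_def \<F>0_def)
    define T where "T = {q \<in> P. multiplicity q a \<noteq> multiplicity q b}"
    have "p dvd a" by (rule ccontr) (use p(2) in \<open>simp add: not_dvd_imp_multiplicity_0\<close>)
    then have "p \<le> N" using pos(1,2) by (meson dvd_imp_le le_trans)
    \<comment> \<open>The multiplicities agree at all primes of \<open>Q\<close>, so the obstructing
      prime \<open>p\<close> is at most \<open>\<kappa>\<close>.\<close>
    have "p \<notin> Q" using prime_part_eqD[OF rough fin(3) pr(4), of p] p by auto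
    then have "p \<in> T" using p \<open>p \<le> N\<close> by (auto simp: T_def P_def Q_def not_le)
    show False
    proof (cases "card T \<le> t")
      case True
      then obtain S where S: "S \<in> \<S>" "S \<inter> T = {p}"
        using iso(2)[of T p] \<open>p \<in> T\<close> by (auto simp: T_def)
      have "prime_part S b < prime_part S a"
      proof (rule prime_part_less)
        show "finite S" using S(1) iso(1) finP finite_subset by blast
        show "p \<in> S" using S by blast
        show "multiplicity q b = multiplicity q a" if "q \<in> S" "q \<noteq> p" for q
        proof -
          have "q \<in> P" "q \<notin> T" using that S iso(1) by blast+
          then show ?thesis by (simp add: T_def)
        qed
      qed (use S prS p in auto)
      then show False
        using le[of "\<lambda>n. real (prime_part S n)"] S(1) by (simp add: \<F>_def \<F>1_def)
    next
      case False
      have "card T \<le> card A + card (T \<inter> B)"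
      proof -
        have "T \<subseteq> A \<union> (T \<inter> B)" using AB by (auto simp: T_def)
        then have "card T \<le> card (A \<union> (T \<inter> B))" using fin by (intro card_mono) auto
        then show ?thesis using card_Un_le le_trans by blast
      qed
      then have "2 * g \<le> card (T \<inter> B)" using False card_le by linarith
      then obtain T0 where T0: "T0 \<subseteq> T \<inter> B" "card T0 = 2 * g"
        using obtain_subset_with_card_n by metis
      then obtain h where h: "h \<in> H" "g < card (h ` T0)" using spread(3)[of T0] by auto
      have hB: "h ` B \<subseteq> {..<m}" using h spread(2) by (auto simp: PiE_iff)
      \<comment> \<open>The logarithmic growth of the \<open>S\<close>-part from \<open>a\<close> to
        \<open>b\<close>.\<close>
      define d where "d S = ln (real (prime_part S b)) - ln (real (prime_part S a))" for S
      have d0: "0 \<le> d (fib h j)" if "j < m" for j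
        unfolding d_def
        by (rule level_family_gap(1)[of y "Suc N"])
          (use le h that \<open>y > 1\<close> fin(4) pr(5) in \<open>auto simp: \<F>_def \<F>2_def\<close>)
      have d1: "ln y / 2 \<le> d (fib h j)" if "j \<in> h ` T0" for j
        unfolding d_def
      proof (rule level_family_gap(2)[of y "Suc N"])
        show "f a \<le> f b" if "f \<in> level_family y (Suc N) (fib h j)" for f
          using le[of f] that h hB \<open>j \<in> h ` T0\<close> T0 unfolding \<F>_def \<F>2_def by blast
        show "\<exists>p\<in>fib h j. multiplicity p a \<noteq> multiplicity p b"
          using that T0 by (auto simp: T_def fib_def)
      qed (use \<open>y > 1\<close> fin(4) pr(5) in auto)
      \<comment> \<open>The small primes must not give back what the fibres gain.\<close>
      have dA: "0 \<le> d A"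
        unfolding d_def
        by (rule level_family_gap(1)[of 2 "Suc N"])
          (use le fin(1) pr(2) in \<open>auto simp: \<F>_def\<close>)
      \<comment> \<open>The growth is additive over the blocks, and the \<open>Q\<close> terms will
        cancel between \<open>a\<close> and \<open>b\<close>.\<close>
      have full: "ln (real n) = ln (real (prime_part A n)) + (\<Sum>j<m. ln (real (prime_part (fib h j) n)))
          + ln (real (prime_part Q n))" if "n \<in> R" for n
      proof -
        have "prime_part (P \<union> Q) n = n"
        proof (rule prime_part_eq_self)
          show "prime_factors n \<subseteq> P \<union> Q"
          proof
            fix q assume "q \<in> prime_factors n"
            then have "prime q" "q dvd n" by auto
            moreover have "q \<le> N" using dvd_imp_le[OF \<open>q dvd n\<close>] Rpos[OF that] by simp
            ultimately show "q \<in> P \<union> Q" by (auto simp: P_def Q_def)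
          qed
        qed (use finP fin pr Rpos[OF that] in auto)
        moreover have "ln (real (prime_part (P \<union> Q) n)) =
            ln (real (prime_part P n)) + ln (real (prime_part Q n))"
          by (rule ln_prime_part_Un) (use finP fin pr PQ in auto)
        moreover have "ln (real (prime_part P n)) =
            ln (real (prime_part A n)) + ln (real (prime_part B n))"
          unfolding AB(1)[symmetric] by (rule ln_prime_part_Un) (use fin pr AB in auto)
        moreover have "ln (real (prime_part B n)) = (\<Sum>j<m. ln (real (prime_part (fib h j) n)))"
          unfolding fib_def by (rule ln_prime_part_fibres) (use fin pr hB in auto)
        ultimately show ?thesis by simp
      qed
      \<comment> \<open>More than \<open>g\<close> fibres meet \<open>T0\<close> and gain at least
        \<open>ln y / 2\<close> each, and no other block loses; yet the total gain is at most
        \<open>ln \<kappa>\<close>.\<close>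
      have "real (g + 1) * (ln y / 2) \<le> real (card (h ` T0)) * (ln y / 2)"
        using h \<open>y > 1\<close> by (intro mult_right_mono) auto
      also have "\<dots> = (\<Sum>j\<in>h ` T0. ln y / 2)" by simp
      also have "\<dots> \<le> (\<Sum>j\<in>h ` T0. d (fib h j))" by (rule sum_mono) (rule d1)
      also have "\<dots> \<le> (\<Sum>j<m. d (fib h j))"
      proof (rule sum_mono2)
        show "h ` T0 \<subseteq> {..<m}" using hB T0 by blast
      qed (simp_all add: d0)
      also have "\<dots> = ln (real b) - ln (real a) - d A"
        using full[OF ab(1)] full[OF ab(2)] rough by (simp add: d_def sum_subtractf)
      also have "\<dots> \<le> ln (real b) - ln (real a)" using dA by simp
      also have "\<dots> \<le> ln \<kappa>"
      proof -
        have "real b \<le> real N" "real N / \<kappa> \<le> real a" using ab by (auto simp: R_def)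
        then have "real b \<le> \<kappa> * real a"
          using \<open>\<kappa> > 1\<close> by (simp add: pos_divide_le_eq mult.commute)
        then have "ln (real b) \<le> ln (\<kappa> * real a)" using pos assms(1) by simp
        then show ?thesis using pos assms(1) by (simp add: ln_mult)
      qed
      finally show False using gap by simp
    qed
  qed
  have "poset_dim R (divisibility_order R) \<le> card \<F>"
    by (rule poset_dim_le_card_family[OF finR partial_order_on_divisibility_order])
      (use finF mono sep in \<open>auto simp: \<F>_def card_level_family\<close>)
  then show ?thesis using cardF by linarith
qed

section \<open>Two chains suffice below 3\<close>

text \<open>For \<open>\<kappa> < 3\<close> every odd prime up to \<open>N\<close> lies in
  \<open>Q\<close>. Distinct \<open>Q\<close>-parts are separated by one of the two signs; with
  equal \<open>Q\<close>-parts, \<open>a\<close> and \<open>b\<close> differ by a power of 2, so if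
  \<open>a\<close> does not divide \<open>b\<close> then \<open>b < a\<close>.\<close>

lemma poset_dim_divisibility_le_2:
  fixes \<kappa> :: real and N :: nat
  assumes "\<kappa> > 0" "\<kappa> < 3" "N > 0"
  defines "R \<equiv> {n. real N / \<kappa> \<le> real n \<and> real n \<le> real N}"
  shows "poset_dim R (divisibility_order R) \<le> 2"
proof -
  define Q where "Q = {p. prime p \<and> \<kappa> < real p \<and> p \<le> N}"
  \<comment> \<open>The factor \<open>Suc N\<close> exceeds every member of \<open>R\<close>, so the
    order is lexicographic: first the \<open>Q\<close>-part with sign \<open>s\<close>, then
    \<open>n\<close>.\<close>
  define f where "f s n = s * (int (Suc N) * int (prime_part Q n)) + int n" for s n
  have finQ: "finite Q" by (rule finite_subset[of _ "{..N}"]) (auto simp: Q_def)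
  have prQ: "\<And>p. p \<in> Q \<Longrightarrow> prime p" by (simp add: Q_def)
  have Rpos: "n > 0" "n \<le> N" if "n \<in> R" for n
    using mem_intervalD[OF assms(1,3) that[unfolded R_def]] .
  have finR: "finite R" unfolding R_def by (rule finite_interval)
  have "poset_dim R (divisibility_order R) \<le> card {f 1, f (- 1)}"
  proof (rule poset_dim_le_card_family[OF finR partial_order_on_divisibility_order])
    fix g a b assume g: "g \<in> {f 1, f (- 1)}" and ab: "(a, b) \<in> divisibility_order R"
    then have R: "a \<in> R" "b \<in> R" "a dvd b" by (auto simp: divisibility_order_def)
    have "prime_part Q a = prime_part Q b"
    proof (rule prime_part_rough_eq[OF assms(1,3) R(3) R(1,2)[unfolded R_def] finQ prQ])
      show "\<kappa> < real p" if "p \<in> Q" for p using that unfolding Q_def by blast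
    qed
    moreover have "a \<le> b" using R Rpos by (simp add: dvd_imp_le)
    ultimately show "g a \<le> g b" using g by (auto simp: f_def)
  next
    fix a b assume ab: "a \<in> R" "b \<in> R" "(a, b) \<notin> divisibility_order R"
    note pos = Rpos[OF ab(1)] Rpos[OF ab(2)]
    have nd: "\<not> a dvd b" using ab by (simp add: divisibility_order_def)
    have sN: "int (Suc N) * u + int b < int (Suc N) * v + int a" if "u < v" for u v
    proof -
      have "int (Suc N) * (u + 1) \<le> int (Suc N) * v" using that by (intro mult_left_mono) auto
      then have "int (Suc N) * u + int (Suc N) \<le> int (Suc N) * v" by (simp only: distrib_left mult_1_right)
      then show ?thesis using pos by linarith
    qed
    consider "prime_part Q b < prime_part Q a" | "prime_part Q a < prime_part Q b"
      | "prime_part Q a = prime_part Q b" by linarith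
    then show "\<exists>g\<in>{f 1, f (- 1)}. g b < g a"
    proof cases
      case 1
      then have "f 1 b < f 1 a" using sN[of "int (prime_part Q b)" "int (prime_part Q a)"]
        unfolding f_def by simp
      then show ?thesis by blast
    next
      case 2
      then have "f (- 1) b < f (- 1) a" using sN[of "- int (prime_part Q b)" "- int (prime_part Q a)"]
        unfolding f_def by simp
      then show ?thesis by blast
    next
      case 3
      have eq: "multiplicity q b = multiplicity q a" if "prime q" "q \<noteq> 2" for q
      proof (cases "q \<le> N")
        case True
        have "q > 2" using prime_ge_2_nat[OF that(1)] that(2) by linarith
        then have "q \<in> Q" using that True assms(2) by (simp add: Q_def)
        then show ?thesis using prime_part_eqD[OF 3 finQ prQ] by simp
      next
        case False
        then have "\<not> q dvd a" "\<not> q dvd b" using pos dvd_imp_le le_trans by blast+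
        then show ?thesis by (simp add: not_dvd_imp_multiplicity_0)
      qed
      have lt: "multiplicity 2 b < multiplicity 2 a"
      proof (rule ccontr)
        assume "\<not> ?thesis"
        then have "multiplicity q a \<le> multiplicity q b" if "prime q" for q
          using eq[OF that] by (cases "q = 2") auto
        then have "a dvd b" using pos by (intro multiplicity_le_imp_dvd) simp_all
        then show False using nd by simp
      qed
      have "multiplicity q b \<le> multiplicity q a" if "prime q" for q
        using eq[OF that] lt by (cases "q = 2") auto
      then have "b dvd a" using pos by (intro multiplicity_le_imp_dvd) simp_all
      then have "b \<le> a" "b \<noteq> a" using pos nd by (auto simp: dvd_imp_le)
      then have "f 1 b < f 1 a" using 3 unfolding f_def by simp
      then show ?thesis by blast
    qed
  qed simp
  also have "\<dots> \<le> 2" by (simp add: card_insert_le_m1)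
  finally show ?thesis .
qed

section \<open>Choice of parameters and numerical estimates\<close>

lemma card_primes_le:
  assumes "x \<ge> 0"
  shows "finite {p :: nat. prime p \<and> real p \<le> x}" "real (card {p :: nat. prime p \<and> real p \<le> x}) \<le> x"
proof -
  have sub: "{p :: nat. prime p \<and> real p \<le> x} \<subseteq> {1..nat \<lfloor>x\<rfloor>}"
    by (auto simp: le_nat_floor Suc_le_eq prime_gt_0_nat)
  then show "finite {p :: nat. prime p \<and> real p \<le> x}" by (rule finite_subset) simp
  have "card {p :: nat. prime p \<and> real p \<le> x} \<le> card {1..nat \<lfloor>x\<rfloor>}" using sub by (rule card_mono[rotated]) simp
  then have "card {p :: nat. prime p \<and> real p \<le> x} \<le> nat \<lfloor>x\<rfloor>" by simp
  then show "real (card {p :: nat. prime p \<and> real p \<le> x}) \<le> x"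
    using assms of_nat_floor[of x] by linarith
qed

text \<open>Taking \<open>y = \<kappa> + 1\<close> empties the block \<open>B\<close>, and
  singletons isolate every prime, so the general bound becomes 5 plus the number of primes up to
  \<open>\<kappa>\<close>. This serves for moderate \<open>\<kappa>\<close>.\<close>

lemma poset_dim_divisibility_le_linear:
  fixes \<kappa> :: real and N :: nat
  assumes "\<kappa> > 1" "N > 0"
  defines "R \<equiv> {n. real N / \<kappa> \<le> real n \<and> real n \<le> real N}"
  shows "real (poset_dim R (divisibility_order R)) \<le> \<kappa> + 5"
proof -
  let ?P = "{p :: nat. prime p \<and> real p \<le> \<kappa>}"
  have P: "finite ?P" "real (card ?P) \<le> \<kappa>" using card_primes_le[of \<kappa>] assms(1) by auto
  have B: "{p \<in> ?P. \<kappa> + 1 < real p} = {}" by auto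
  have "poset_dim R (divisibility_order R) \<le> 5 + card ((\<lambda>p. {p}) ` ?P) + 3 * (card ({} :: (nat \<Rightarrow> nat) set) * 0)"
    unfolding R_def
  proof (rule poset_dim_divisibility_le[where y = "\<kappa> + 1" and g = 1])
    show "card {p \<in> ?P. real p \<le> \<kappa> + 1} + 2 * 1 \<le> card {p \<in> ?P. real p \<le> \<kappa> + 1} + 2" by simp
    show "\<exists>S\<in>(\<lambda>p. {p}) ` ?P. S \<inter> T = {p}" if "T \<subseteq> ?P" "p \<in> T" for T p
    proof (rule bexI)
      show "{p} \<inter> T = {p}" using that(2) by simp
      show "{p} \<in> (\<lambda>p. {p}) ` ?P" using that by (intro imageI) (rule subsetD)
    qed
    show "(\<lambda>p. {p}) ` ?P \<subseteq> Pow ?P" by blast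
    show "\<exists>h\<in>{}. 1 < card (h ` T)" if "T \<subseteq> {p \<in> ?P. \<kappa> + 1 < real p}" "card T = 2 * 1"
      for T :: "nat set"
      using that unfolding B by simp
    have "ln \<kappa> < ln (\<kappa> + 1)" using assms(1) by simp
    then show "ln \<kappa> < real (1 + 1) * (ln (\<kappa> + 1) / 2)" by simp
  qed (use assms(1,2) in simp_all)
  also have "\<dots> \<le> 5 + card ?P" using card_image_le[OF P(1)] by simp
  finally show ?thesis using P(2) by linarith
qed

lemma ln_le_half: "x > 0 \<Longrightarrow> ln x \<le> x / 2" for x :: real
  using ln_le_minus_one[of "x / 2"] ln_le_minus_one[of 2] by (simp add: ln_div)

text \<open>The choice \<open>y = sqrt L\<close> balances two needs: there are at most
  \<open>y \<le> K\<close> small primes, while \<open>ln y = l / 2\<close> is large enough for about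
  \<open>4 * K\<close> fibres to exhaust \<open>ln \<kappa>\<close>.\<close>

lemma poset_dim_divisibility_le_polylog:
  fixes \<kappa> :: real and N :: nat
  assumes "\<kappa> > 0" "N > 0" "ln \<kappa> \<ge> 5"
  defines "R \<equiv> {n. real N / \<kappa> \<le> real n \<and> real n \<le> real N}"
  shows "real (poset_dim R (divisibility_order R)) \<le> 688 * (ln \<kappa> ^ 3 / (ln (ln \<kappa>))\<^sup>2)"
proof -
  define L where "L = ln \<kappa>"
  define l where "l = ln L"
  define K where "K = L / l"
  define y where "y = sqrt L"
  define g where "g = nat \<lfloor>4 * K\<rfloor>"
  let ?P = "{p :: nat. prime p \<and> real p \<le> \<kappa>}"
  let ?A = "{p \<in> ?P. real p \<le> y}" and ?B = "{p \<in> ?P. y < real p}"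
  define t where "t = card ?A + 2 * g"
  \<comment> \<open>\<open>M\<close> and \<open>r\<close> lie just above the thresholds
    \<open>3 * t\<^sup>2 * L\<close> and \<open>2 * L\<close> past which the union bounds for the
    isolating sets and for the colourings drop below 1.\<close>
  define M where "M = nat \<lfloor>3 * (real t)\<^sup>2 * L\<rfloor> + 1"
  define r where "r = nat \<lfloor>2 * L\<rfloor> + 1"
  have L: "L \<ge> 5" using assms by (simp add: L_def)
  have \<kappa>: "\<kappa> = exp L" using assms(1) by (simp add: L_def)
  have \<kappa>1: "\<kappa> > 1" unfolding \<kappa> using L by simp
  have l: "l > 0" "l \<le> L / 2" using L ln_le_half[of L] by (simp_all add: l_def)
  have "K \<ge> 2" using l L by (simp add: K_def field_simps)
  have y: "y > 1" "y > 0" "ln y = l / 2" "y * y = L" using L by (simp_all add: y_def l_def ln_sqrt)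
  \<comment> \<open>Since \<open>l = 2 * ln y \<le> y\<close>.\<close>
  have "y * l \<le> L" using ln_le_half[of y] y mult_left_mono[of l y y] by simp
  then have "y \<le> K" using l by (simp add: K_def field_simps)
  have g: "real g \<le> 4 * K" "4 * K < real g + 1" using \<open>K \<ge> 2\<close> by (simp_all add: g_def)
  have "g > 0" using g \<open>K \<ge> 2\<close> by linarith
  have P: "finite ?P" "real (card ?P) \<le> exp L" using card_primes_le[of \<kappa>] \<kappa> assms(1) by auto
  have "?A \<subseteq> {p. prime p \<and> real p \<le> y}" by auto
  then have "card ?A \<le> card {p :: nat. prime p \<and> real p \<le> y}"
    using card_primes_le(1)[of y] y by (intro card_mono) auto
  then have "real (card ?A) \<le> y" using card_primes_le(2)[of y] y by linarith
  then have t: "real t \<le> 9 * K" "t > 0" using g \<open>y \<le> K\<close> \<open>g > 0\<close> by (simp_all add: t_def)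
  have M: "3 * (real t)\<^sup>2 * L < real M" "real M \<le> 3 * (real t)\<^sup>2 * L + 1"
  proof -
    have "0 \<le> 3 * (real t)\<^sup>2 * L" using L by simp
    then show "3 * (real t)\<^sup>2 * L < real M" "real M \<le> 3 * (real t)\<^sup>2 * L + 1"
      unfolding M_def by linarith+
  qed
  have r: "2 * L < real r" "real r \<le> 2 * L + 1" using L unfolding r_def by linarith+
  have "real (card ?P) ^ t * (1 - 1 / (3 * real t)) ^ M < 1"
  proof -
    \<comment> \<open>Here \<open>1 - x \<le> exp (- x)\<close> reduces the claim to
      \<open>t * L < M / (3 * t)\<close>.\<close>
    have "real (card ?P) ^ t * (1 - 1 / (3 * real t)) ^ M \<le> exp L ^ t * exp (- (1 / (3 * real t))) ^ M"
      using P(2) t(2) exp_ge_add_one_self[of "- (1 / (3 * real t))"]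
      by (intro mult_mono power_mono) (auto simp: field_simps)
    also have "\<dots> = exp (real t * L - real M / (3 * real t))"
      by (simp add: exp_of_nat_mult[symmetric] exp_add[symmetric] field_simps)
    also have "\<dots> < 1"
    proof -
      have "real t * L * (3 * real t) < real M" using M(1) by (simp add: power2_eq_square mult_ac)
      then have "real t * L < real M / (3 * real t)" using t(2) by (simp add: pos_less_divide_eq)
      then show ?thesis by simp
    qed
    finally show ?thesis .
  qed
  from isolating_family[OF P(1) t(2) this] obtain \<S> where \<S>: "\<S> \<subseteq> Pow ?P" "card \<S> \<le> M"
    "\<forall>T p. T \<subseteq> ?P \<longrightarrow> card T \<le> t \<longrightarrow> p \<in> T \<longrightarrow> (\<exists>S\<in>\<S>. S \<inter> T = {p})"
    by (elim exE conjE)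
  have finB: "finite ?B" by (rule finite_subset[OF _ P(1)]) auto
  have "real (card ?B) ^ (2 * g) * ((1 / 3) ^ g) ^ r < 1"
  proof -
    have "card ?B \<le> card ?P" by (rule card_mono[OF P(1)]) auto
    then have "real (card ?B) \<le> exp L" using P(2) by linarith
    moreover have "1 / 3 \<le> exp (- 1 :: real)" using exp_le by (simp add: exp_minus field_simps)
    ultimately have "real (card ?B) ^ (2 * g) * ((1 / 3) ^ g) ^ r \<le> exp L ^ (2 * g) * (exp (- 1) ^ g) ^ r"
      by (intro mult_mono power_mono) auto
    also have "\<dots> = exp (real g * (2 * L - real r))"
      by (simp add: exp_of_nat_mult[symmetric] exp_add[symmetric] algebra_simps)
    also have "\<dots> < 1" using r(1) \<open>g > 0\<close> by (simp add: mult_pos_neg)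
    finally show ?thesis .
  qed
  from spreading_family[OF finB \<open>g > 0\<close> this] obtain H where
    H: "H \<subseteq> ?B \<rightarrow>\<^sub>E {..<3 * g\<^sup>2}" "card H \<le> r"
    "\<forall>T. T \<subseteq> ?B \<longrightarrow> card T = 2 * g \<longrightarrow> (\<exists>h\<in>H. g < card (h ` T))"
    by (elim exE conjE)
  have finH: "finite H" using H(1) by (rule finite_subset) (intro finite_PiE finB finite_lessThan)
  have gap: "ln \<kappa> < real (g + 1) * (ln y / 2)"
  proof -
    have "L = K * l" using l by (simp add: K_def)
    then have "ln \<kappa> = 4 * K * (l / 4)" by (simp add: L_def)
    also have "\<dots> < (real g + 1) * (l / 4)" using g l by (intro mult_strict_right_mono) auto
    finally show ?thesis by (simp add: y add.commute)
  qed
  have "poset_dim R (divisibility_order R) \<le> 5 + card \<S> + 3 * (card H * (3 * g\<^sup>2))"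
    unfolding R_def
    by (rule poset_dim_divisibility_le[OF \<kappa>1 \<open>N > 0\<close> y(1) _ \<S>(1) \<S>(3)[rule_format] finH H(1) H(3)[rule_format] gap])
      (simp_all add: t_def)
  also have "\<dots> \<le> 5 + M + 3 * (r * (3 * g\<^sup>2))"
    using \<S>(2) H(2) by (intro add_mono mult_left_mono mult_right_mono) auto
  finally have "real (poset_dim R (divisibility_order R)) \<le> real (5 + M + 3 * (r * (3 * g\<^sup>2)))"
    by (simp only: of_nat_le_iff)
  also have "\<dots> = 5 + real M + 9 * real r * (real g)\<^sup>2" by simp
  \<comment> \<open>From \<open>L \<ge> 5\<close> follows \<open>2 * L + 1 \<le> 11 / 5 * L\<close>.
    The coefficients of \<open>K\<^sup>2 * L\<close> are 243 and 316.8, with sum 559.8.\<close>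
  also have "\<dots> \<le> 5 + (3 * (9 * K)\<^sup>2 * L + 1) + 9 * (11 / 5 * L) * (4 * K)\<^sup>2"
  proof (intro add_mono mult_mono power_mono)
    have "(real t)\<^sup>2 \<le> (9 * K)\<^sup>2" using t by (intro power_mono) auto
    then have "3 * (real t)\<^sup>2 * L \<le> 3 * (9 * K)\<^sup>2 * L" using L by (intro mult_right_mono) auto
    then show "real M \<le> 3 * (9 * K)\<^sup>2 * L + 1" using M(2) by linarith
    show "real r \<le> 11 / 5 * L" using r(2) L by linarith
  qed (use g L in auto)
  also have "\<dots> = 6 + (2799 / 5) * (K\<^sup>2 * L)" by (simp add: power_mult_distrib)
  also have "\<dots> \<le> 688 * (K\<^sup>2 * L)"
  proof -
    \<comment> \<open>The room between 559.8 and 688 then absorbs the constant 6.\<close>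
    have "K\<^sup>2 * L \<ge> 2\<^sup>2 * 5" using \<open>K \<ge> 2\<close> L by (intro mult_mono power_mono) auto
    then show ?thesis by simp
  qed
  also have "K\<^sup>2 * L = ln \<kappa> ^ 3 / (ln (ln \<kappa>))\<^sup>2"
    by (simp add: K_def l_def L_def power_divide power2_eq_square power3_eq_cube)
  finally show ?thesis .
qed

text \<open>The range of \<open>\<kappa>\<close> is split at 3 and at \<open>exp 5\<close>: two
  chains suffice below 3, the linear bound is good enough in between, and the random construction
  takes over from \<open>ln \<kappa> = 5\<close> on.\<close>

theorem theorem1p7:
  fixes \<kappa> :: real and N :: nat and R :: "nat set"
  assumes "\<kappa> > 1" and "N > 0"
  defines "R \<equiv> {n. real N / \<kappa> \<le> real n \<and> real n \<le> real N}"
  shows "ereal (real (poset_dim R (divisibility_order R))) \<le> dim_bound \<kappa>"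
proof (cases "\<kappa> < 3")
  case True
  then have "poset_dim R (divisibility_order R) \<le> 2"
    unfolding R_def using assms(1,2) by (intro poset_dim_divisibility_le_2) auto
  then have "ereal (real (poset_dim R (divisibility_order R))) \<le> 2" by simp
  then show ?thesis unfolding dim_bound_def by (rule max.coboundedI2)
next
  case False
  define L where "L = ln \<kappa>"
  have "ln (exp 1) \<le> L" unfolding L_def using False exp_le by (subst ln_le_cancel_iff) auto
  then have "L \<ge> 1" by simp
  show ?thesis
  proof (cases "ln L = 0")
    case True
    then show ?thesis by (simp add: dim_bound_def L_def)
  next
    case nz: False
    have "real (poset_dim R (divisibility_order R)) \<le> 688 * (L ^ 3 / (ln L)\<^sup>2)"
    proof (cases "L \<ge> 5")
      case True
      then show ?thesis
        unfolding R_def L_def using assms(1,2) by (intro poset_dim_divisibility_le_polylog) auto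
    next
      case False
      have "real (poset_dim R (divisibility_order R)) \<le> \<kappa> + 5"
        unfolding R_def using assms(1,2) by (rule poset_dim_divisibility_le_linear)
      also have "\<kappa> = exp L" using assms(1) by (simp add: L_def)
      also have "exp L \<le> exp 5" using False by simp
      also have "exp 5 = exp (1 :: real) ^ 5" by (simp add: exp_of_nat_mult[symmetric])
      also have "\<dots> \<le> 3 ^ 5" by (intro power_mono exp_le) simp
      \<comment> \<open>The left side is 248, the right side at least 2752.\<close>
      also have "(3 :: real) ^ 5 + 5 \<le> 688 * (4 * L)" using \<open>L \<ge> 1\<close> by simp
      \<comment> \<open>From \<open>0 \<le> ln L \<le> L / 2\<close> the quotient is at least
        \<open>4 * L\<close>.\<close>
      also have "\<dots> \<le> 688 * (L ^ 3 / (ln L)\<^sup>2)"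
      proof -
        have "(ln L)\<^sup>2 \<le> (L / 2)\<^sup>2" using \<open>L \<ge> 1\<close> ln_le_half[of L] by (intro power_mono) auto
        then have "4 * L * (ln L)\<^sup>2 \<le> 4 * L * (L / 2)\<^sup>2" using \<open>L \<ge> 1\<close> by (intro mult_left_mono) auto
        also have "\<dots> = L ^ 3" by (simp add: power2_eq_square power3_eq_cube)
        finally show ?thesis using nz by (simp add: pos_le_divide_eq)
      qed
      finally show ?thesis by simp
    qed
    then show ?thesis
      using nz unfolding dim_bound_def L_def by (intro max.coboundedI1) simp
  qed
qed

end
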